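(* Let $\langle (S^i_a)^{i\in I}_{a\in A},(BR_a)_{a\in A}\rangle$ be an ndbr multi strategic game. Let $\sigma\in\Sigma$. Assume that for all agents $a\in A$ and all $\gamma_1,\dots,\gamma_n\in\Sigma_{-a}$, if $\gamma_n\subseteq\dots\subseteq\gamma_1\subseteq\sigma_{-a}$ then $\bigcap_{1\leq k\leq n}BR_a(\gamma_k)\cap\sigma_a\neq\emptyset$. Then the game has an ndbr equilibrium, i.e. there exists $\tau\in\Sigma$ such that $\tau_a\subseteq BR_a(\tau_{-a})$ for every $a\in A$.
   Context: A non deterministic best response (ndbr) multi strategic game is a pair $\langle (S^i_a)^{i\in I}_{a\in A},(BR_a)_{a\in A}\rangle$ where $I$ is a non-empty set of indices, $A$ is a non-empty set of agents, the $S^i_a$ are sets (of strategies), and for each $a\in A$, $BR_a$ is a function from $\Sigma_{-a}$ to $\Sigma_a$. Here $\Sigma_a=\prod_{i\in I}(\mathcal{P}(S^i_a)\setminus\{\emptyset\})$, $\Sigma=\prod_{a\in A}\Sigma_a$, $\Sigma_{-a}=\prod_{a'\in A\setminus\{a\}}\Sigma_{a'}$. For $\sigma\in\Sigma$, $\sigma_a$ and $\sigma_{-a}$ denote its projections on $\Sigma_a$ and $\Sigma_{-a}$. A family of non-empty sets is identified with the Cartesian product of its components. So inclusion $\subseteq$ between elements of $\Sigma$ (or $\Sigma_a$, $\Sigma_{-a}$) is componentwise inclusion, intersection is componentwise intersection, and an intersection is $\neq\emptyset$ iff all of its components are non-empty.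
   Formalization: The formal statement also assumes that every component of σ is a finite set; for infinite components the claim fails, e.g. two agents choosing sets of natural numbers, each responding with all numbers above the minimum of the other's set. *)

theory Defs
  imports "HOL-Library.FuncSet"
begin

text \<open>
  \<open>S i a\<close> is the set of strategies of agent \<open>a\<close> at index \<open>i\<close>. Families are extensional functions,
  so that equality of members of the sets below is equality of families over the index sets.
\<close>

definition agent_choices :: "'i set \<Rightarrow> ('i \<Rightarrow> 'a \<Rightarrow> 's set) \<Rightarrow> 'a \<Rightarrow> ('i \<Rightarrow> 's set) set" where
  "agent_choices I S a = (\<Pi>\<^sub>E i\<in>I. Pow (S i a) - {{}})"

definition profiles :: "'i set \<Rightarrow> 'a set \<Rightarrow> ('i \<Rightarrow> 'a \<Rightarrow> 's set) \<Rightarrow> ('a \<Rightarrow> 'i \<Rightarrow> 's set) set" where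
  "profiles I A S = (\<Pi>\<^sub>E a\<in>A. agent_choices I S a)"

definition opponent_profiles ::
    "'i set \<Rightarrow> 'a set \<Rightarrow> ('i \<Rightarrow> 'a \<Rightarrow> 's set) \<Rightarrow> 'a \<Rightarrow> ('a \<Rightarrow> 'i \<Rightarrow> 's set) set" where
  "opponent_profiles I A S a = profiles I (A - {a}) S"

definition others :: "'a set \<Rightarrow> 'a \<Rightarrow> ('a \<Rightarrow> 'i \<Rightarrow> 's set) \<Rightarrow> ('a \<Rightarrow> 'i \<Rightarrow> 's set)" where
  "others A a \<sigma> = restrict \<sigma> (A - {a})"

definition choice_subset :: "'i set \<Rightarrow> ('i \<Rightarrow> 's set) \<Rightarrow> ('i \<Rightarrow> 's set) \<Rightarrow> bool" where
  "choice_subset I x y \<longleftrightarrow> (\<forall>i\<in>I. x i \<subseteq> y i)"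

definition profile_subset ::
    "'i set \<Rightarrow> 'a set \<Rightarrow> ('a \<Rightarrow> 'i \<Rightarrow> 's set) \<Rightarrow> ('a \<Rightarrow> 'i \<Rightarrow> 's set) \<Rightarrow> bool" where
  "profile_subset I A \<sigma> \<tau> \<longleftrightarrow> (\<forall>a\<in>A. choice_subset I (\<sigma> a) (\<tau> a))"

definition ndbr_game ::
    "'i set \<Rightarrow> 'a set \<Rightarrow> ('i \<Rightarrow> 'a \<Rightarrow> 's set) \<Rightarrow>
      ('a \<Rightarrow> ('a \<Rightarrow> 'i \<Rightarrow> 's set) \<Rightarrow> 'i \<Rightarrow> 's set) \<Rightarrow> bool" where
  "ndbr_game I A S BR \<longleftrightarrow>
     I \<noteq> {} \<and> A \<noteq> {} \<and> (\<forall>a\<in>A. BR a \<in> opponent_profiles I A S a \<rightarrow> agent_choices I S a)"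

definition ndbr_equilibrium ::
    "'i set \<Rightarrow> 'a set \<Rightarrow> ('i \<Rightarrow> 'a \<Rightarrow> 's set) \<Rightarrow>
      ('a \<Rightarrow> ('a \<Rightarrow> 'i \<Rightarrow> 's set) \<Rightarrow> 'i \<Rightarrow> 's set) \<Rightarrow> ('a \<Rightarrow> 'i \<Rightarrow> 's set) \<Rightarrow> bool" where
  "ndbr_equilibrium I A S BR \<tau> \<longleftrightarrow>
     \<tau> \<in> profiles I A S \<and> (\<forall>a\<in>A. choice_subset I (\<tau> a) (BR a (others A a \<tau>)))"

text \<open>
  The hypothesis on \<open>\<sigma>\<close>. Along a finite decreasing chain \<open>\<gamma> 1, \<dots>, \<gamma> n\<close> below \<open>\<sigma>\<close>, the
  componentwise intersection of the best responses and of \<open>\<sigma> a\<close> is non-empty, which means that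
  each of its components is non-empty. The chain constraint \<open>\<gamma> 1 \<subseteq> \<sigma>\<close> presupposes \<open>1 \<le> n\<close>; an
  empty chain would only require \<open>\<sigma> a\<close> to have non-empty components.
\<close>

definition chain_condition ::
    "'i set \<Rightarrow> 'a set \<Rightarrow> ('i \<Rightarrow> 'a \<Rightarrow> 's set) \<Rightarrow>
      ('a \<Rightarrow> ('a \<Rightarrow> 'i \<Rightarrow> 's set) \<Rightarrow> 'i \<Rightarrow> 's set) \<Rightarrow> ('a \<Rightarrow> 'i \<Rightarrow> 's set) \<Rightarrow> bool" where
  "chain_condition I A S BR \<sigma> \<longleftrightarrow>
     (\<forall>a\<in>A. \<forall>(n::nat) \<gamma>. 1 \<le> n \<longrightarrow>
        (\<forall>k\<in>{1..n}. \<gamma> k \<in> opponent_profiles I A S a) \<longrightarrow>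
        profile_subset I (A - {a}) (\<gamma> 1) (others A a \<sigma>) \<longrightarrow>
        (\<forall>k\<in>{1..<n}. profile_subset I (A - {a}) (\<gamma> (Suc k)) (\<gamma> k)) \<longrightarrow>
        (\<forall>i\<in>I. (\<Inter>k\<in>{1..n}. BR a (\<gamma> k) i) \<inter> \<sigma> a i \<noteq> {}))"

text \<open>
  If \<open>\<sigma>\<close> may have infinite components, the chain condition does not ensure an equilibrium: take
  two agents who choose sets of natural numbers, each responding with the numbers above the
  minimum of the other's set.
\<close>

lemma chain_condition_not_sufficient:
  "\<exists>(I :: unit set) (A :: bool set) (S :: unit \<Rightarrow> bool \<Rightarrow> nat set) BR \<sigma>.
     ndbr_game I A S BR \<and> \<sigma> \<in> profiles I A S \<and> chain_condition I A S BR \<sigma> \<and>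
     (\<nexists>\<tau>. ndbr_equilibrium I A S BR \<tau>)"
proof -
  define I where "I = (UNIV :: unit set)"
  define A where "A = (UNIV :: bool set)"
  define S where "S = (\<lambda>(_::unit) (_::bool). UNIV :: nat set)"
  define BR where "BR = (\<lambda>(a::bool) (\<gamma> :: bool \<Rightarrow> unit \<Rightarrow> nat set) (_::unit). {Inf (\<gamma> (\<not> a) ())<..})"
  define \<sigma> where "\<sigma> = (\<lambda>(_::bool) (_::unit). UNIV :: nat set)"
  note defs = I_def A_def S_def BR_def \<sigma>_def
  have "ndbr_game I A S BR"
    by (auto simp: defs ndbr_game_def agent_choices_def)
  moreover have "\<sigma> \<in> profiles I A S"
    by (auto simp: defs profiles_def agent_choices_def)
  moreover have "chain_condition I A S BR \<sigma>"
  proof -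
    have "(\<Inter>k\<in>{1..n}. BR a (\<gamma> k) i) \<noteq> {}" for a n i and \<gamma> :: "nat \<Rightarrow> bool \<Rightarrow> unit \<Rightarrow> nat set"
    proof -
      let ?m = "\<Sum>k\<in>{1..n}. Inf (\<gamma> k (\<not> a) ())"
      have "Suc ?m \<in> (\<Inter>k\<in>{1..n}. BR a (\<gamma> k) i)"
        by (auto simp: BR_def less_Suc_eq_le intro: member_le_sum)
      then show ?thesis by blast
    qed
    then show ?thesis by (simp add: chain_condition_def \<sigma>_def)
  qed
  moreover have "\<not> ndbr_equilibrium I A S BR \<tau>" for \<tau>
  proof
    assume eq: "ndbr_equilibrium I A S BR \<tau>"
    have "Inf (\<tau> (\<not> a) ()) < Inf (\<tau> a ())" for a
    proof -
      have "\<tau> a () \<noteq> {}"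
        using eq by (auto simp: ndbr_equilibrium_def profiles_def agent_choices_def defs)
      then have "Inf (\<tau> a ()) \<in> \<tau> a ()" by (rule Inf_nat_def1)
      moreover have "\<tau> a () \<subseteq> {Inf (\<tau> (\<not> a) ())<..}"
        using eq by (auto simp: ndbr_equilibrium_def choice_subset_def others_def defs)
      ultimately show ?thesis by auto
    qed
    from this[of True] this[of False] show False by simp
  qed
  ultimately show ?thesis by blast
qed

end

theory Submission
  imports Defs
begin

text \<open>
  For a set \<open>C\<close> of profiles let \<open>m C\<close> be the intersection of \<open>\<sigma>\<close> with the best responses to all
  members of \<open>C\<close>. Call \<open>C\<close> adequate if it is a chain below \<open>\<sigma>\<close> and \<open>m C\<close> is below every member
  of \<open>C\<close>. Adequate sets are closed under unions of chains, so a maximal one exists by Zorn's lemma.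
  The components of \<open>m C\<close> are non-empty: since those of \<open>\<sigma>\<close> are finite, an empty component is
  already witnessed by a finite subchain, which contradicts the chain condition. Hence adding \<open>m C\<close>
  to \<open>C\<close> preserves adequacy, and for a maximal \<open>C\<close> we get \<open>m C \<in> C\<close>, which says that \<open>m C\<close>
  is contained in the best response to itself. Iterating the best responses from \<open>\<sigma>\<close> also leads
  to an equilibrium, but when there are infinitely many agents or indices the iteration is transfinite.
\<close>

text \<open>Needed because chains occur below as sets, while \<open>chain_condition\<close> speaks
  of decreasing sequences.\<close>

lemma finite_chain_sorted_list:
  fixes T :: "'a::order set"
  assumes "finite T" "\<And>x y. x \<in> T \<Longrightarrow> y \<in> T \<Longrightarrow> x \<le> y \<or> y \<le> x"
  shows "\<exists>xs. set xs = T \<and> sorted_wrt (\<ge>) xs"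
  using assms
proof (induction T rule: finite_induct)
  case (insert x T)
  then obtain xs where xs: "set xs = T" "sorted_wrt (\<ge>) xs" by auto
  \<comment> \<open>By comparability the entries that are not above \<open>x\<close> lie below it,
    so \<open>x\<close> fits between the two filtered parts.\<close>
  let ?ys = "filter (\<lambda>y. x \<le> y) xs @ x # filter (\<lambda>y. \<not> x \<le> y) xs"
  have "set ?ys = insert x T" using xs by auto
  moreover have "sorted_wrt (\<ge>) ?ys"
    using xs insert.prems
    by (auto simp: sorted_wrt_append sorted_wrt_filter) (meson insertI1 insertI2 order_trans)+
  ultimately show ?case by blast
qed simp

definition best_reply_meet ::
    "'i set \<Rightarrow> 'a set \<Rightarrow> ('a \<Rightarrow> ('a \<Rightarrow> 'i \<Rightarrow> 's set) \<Rightarrow> 'i \<Rightarrow> 's set) \<Rightarrow>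
      ('a \<Rightarrow> 'i \<Rightarrow> 's set) \<Rightarrow> ('a \<Rightarrow> 'i \<Rightarrow> 's set) set \<Rightarrow> 'a \<Rightarrow> 'i \<Rightarrow> 's set" where
  "best_reply_meet I A BR \<sigma> C = (\<lambda>a\<in>A. \<lambda>i\<in>I. \<sigma> a i \<inter> (\<Inter>\<gamma>\<in>C. BR a (others A a \<gamma>) i))"

text \<open>The pointwise order on functions can replace \<open>profile_subset\<close> here:
  profiles share one default value outside \<open>A\<close> and \<open>I\<close>, so on them it is
  componentwise inclusion.\<close>

definition adequate ::
    "'i set \<Rightarrow> 'a set \<Rightarrow> ('i \<Rightarrow> 'a \<Rightarrow> 's set) \<Rightarrow>
      ('a \<Rightarrow> ('a \<Rightarrow> 'i \<Rightarrow> 's set) \<Rightarrow> 'i \<Rightarrow> 's set) \<Rightarrow> ('a \<Rightarrow> 'i \<Rightarrow> 's set) \<Rightarrow>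
      ('a \<Rightarrow> 'i \<Rightarrow> 's set) set \<Rightarrow> bool" where
  "adequate I A S BR \<sigma> C \<longleftrightarrow>
     C \<subseteq> profiles I A S \<and> (\<forall>\<gamma>\<in>C. \<gamma> \<le> \<sigma>) \<and> (\<forall>\<gamma>\<in>C. \<forall>\<delta>\<in>C. \<gamma> \<le> \<delta> \<or> \<delta> \<le> \<gamma>) \<and>
     (\<forall>\<gamma>\<in>C. best_reply_meet I A BR \<sigma> C \<le> \<gamma>)"

lemma best_reply_meet_antimono:
  "C \<subseteq> D \<Longrightarrow> best_reply_meet I A BR \<sigma> D \<le> best_reply_meet I A BR \<sigma> C"
  by (auto simp: best_reply_meet_def le_fun_def restrict_def)

lemma best_reply_meet_le:
  assumes "\<sigma> \<in> profiles I A S"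
  shows "best_reply_meet I A BR \<sigma> C \<le> \<sigma>"
proof (intro le_funI)
  fix a i
  show "best_reply_meet I A BR \<sigma> C a i \<le> \<sigma> a i"
  proof (cases "a \<in> A")
    case True
    then have "\<sigma> a \<in> agent_choices I S a" using assms by (auto simp: profiles_def)
    then show ?thesis using True
      by (auto simp: best_reply_meet_def restrict_def agent_choices_def PiE_def extensional_def)
  next
    case False
    then show ?thesis using assms
      by (auto simp: best_reply_meet_def profiles_def PiE_def extensional_def)
  qed
qed

lemma others_in_opponent_profiles:
  "\<gamma> \<in> profiles I A S \<Longrightarrow> others A a \<gamma> \<in> opponent_profiles I A S a"
  by (auto simp: others_def opponent_profiles_def profiles_def)

lemma profile_subset_others:
  "\<gamma> \<le> \<delta> \<Longrightarrow> profile_subset I (A - {a}) (others A a \<gamma>) (others A a \<delta>)"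
  by (simp add: profile_subset_def others_def choice_subset_def le_fun_def)

text \<open>List \<open>T\<close> in decreasing order and drop the component of \<open>a\<close>
  from each entry: this gives a chain to which \<open>chain_condition\<close> applies.\<close>

lemma chain_condition_finite_chain:
  assumes chain: "chain_condition I A S BR \<sigma>" and "a \<in> A" "i \<in> I"
    and T: "finite T" "T \<noteq> {}" "T \<subseteq> profiles I A S" "\<And>\<gamma>. \<gamma> \<in> T \<Longrightarrow> \<gamma> \<le> \<sigma>"
      "\<And>\<gamma> \<delta>. \<gamma> \<in> T \<Longrightarrow> \<delta> \<in> T \<Longrightarrow> \<gamma> \<le> \<delta> \<or> \<delta> \<le> \<gamma>"
  shows "(\<Inter>\<gamma>\<in>T. BR a (others A a \<gamma>) i) \<inter> \<sigma> a i \<noteq> {}"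
proof -
  obtain xs where xs: "set xs = T" "sorted_wrt (\<ge>) xs"
    using finite_chain_sorted_list[OF T(1) T(5)] by blast
  \<comment> \<open>\<open>chain_condition\<close> counts from 1 and lists count from 0, hence the
    shift.\<close>
  define g where "g k = others A a (xs ! (k - 1))" for k
  have len: "1 \<le> length xs"
    using T(2) xs(1) by (cases xs) auto
  have mem: "xs ! (k - 1) \<in> T" if "k \<in> {1..length xs}" for k
    using that xs(1) by (auto intro!: nth_mem)
  have "\<forall>k\<in>{1..length xs}. g k \<in> opponent_profiles I A S a"
    using mem T(3) by (auto simp: g_def intro!: others_in_opponent_profiles)
  moreover have "profile_subset I (A - {a}) (g 1) (others A a \<sigma>)"
    using mem[of 1] len T(4) by (auto simp: g_def intro!: profile_subset_others)
  moreover have "\<forall>k\<in>{1..<length xs}. profile_subset I (A - {a}) (g (Suc k)) (g k)"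
    using sorted_wrt_nth_less[OF xs(2)] by (auto simp: g_def intro!: profile_subset_others)
  ultimately have "(\<Inter>k\<in>{1..length xs}. BR a (g k) i) \<inter> \<sigma> a i \<noteq> {}"
    using chain len \<open>a \<in> A\<close> \<open>i \<in> I\<close> unfolding chain_condition_def by blast
  moreover have "(\<Inter>k\<in>{1..length xs}. BR a (g k) i) \<subseteq> (\<Inter>\<gamma>\<in>T. BR a (others A a \<gamma>) i)"
  proof (intro subsetI INT_I)
    fix s \<gamma> assume s: "s \<in> (\<Inter>k\<in>{1..length xs}. BR a (g k) i)" and "\<gamma> \<in> T"
    then obtain k where "k < length xs" "xs ! k = \<gamma>"
      using xs(1) by (auto simp: in_set_conv_nth)
    then show "s \<in> BR a (others A a \<gamma>) i"
      using INT_D[OF s, of "Suc k"] by (simp add: g_def)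
  qed
  ultimately show ?thesis by blast
qed

lemma best_reply_meet_in_profiles:
  assumes sigma: "\<sigma> \<in> profiles I A S"
    and fin: "\<And>a i. a \<in> A \<Longrightarrow> i \<in> I \<Longrightarrow> finite (\<sigma> a i)"
    and chain: "chain_condition I A S BR \<sigma>"
    and C: "adequate I A S BR \<sigma> C"
  shows "best_reply_meet I A BR \<sigma> C \<in> profiles I A S"
proof -
  have sig: "\<sigma> a i \<subseteq> S i a \<and> \<sigma> a i \<noteq> {}" if "a \<in> A" "i \<in> I" for a i
    using sigma that by (fastforce simp: profiles_def agent_choices_def PiE_iff)
  have "\<sigma> a i \<inter> (\<Inter>\<gamma>\<in>C. BR a (others A a \<gamma>) i) \<noteq> {}" if ai: "a \<in> A" "i \<in> I" for a i
  proof
    assume "\<sigma> a i \<inter> (\<Inter>\<gamma>\<in>C. BR a (others A a \<gamma>) i) = {}"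
    then have "\<forall>s\<in>\<sigma> a i. \<exists>\<gamma>\<in>C. s \<notin> BR a (others A a \<gamma>) i" by blast
    \<comment> \<open>\<open>f s\<close> is a member of \<open>C\<close> whose best response omits
      \<open>s\<close>. As \<open>\<sigma> a i\<close> is finite and non-empty, so is the image of
      \<open>f\<close> on it, and no \<open>s\<close> survives the intersection over this
      image.\<close>
    then obtain f where f: "\<forall>s\<in>\<sigma> a i. f s \<in> C \<and> s \<notin> BR a (others A a (f s)) i"
      by metis
    have "(\<Inter>\<gamma>\<in>f ` \<sigma> a i. BR a (others A a \<gamma>) i) \<inter> \<sigma> a i \<noteq> {}"
    proof (rule chain_condition_finite_chain[OF chain ai])
      have sub: "f ` \<sigma> a i \<subseteq> C" using f by blast
      show "f ` \<sigma> a i \<subseteq> profiles I A S" using sub C by (auto simp: adequate_def)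
      show "\<gamma> \<le> \<sigma>" if "\<gamma> \<in> f ` \<sigma> a i" for \<gamma>
        using sub that C unfolding adequate_def by blast
      show "\<gamma> \<le> \<delta> \<or> \<delta> \<le> \<gamma>" if "\<gamma> \<in> f ` \<sigma> a i" "\<delta> \<in> f ` \<sigma> a i" for \<gamma> \<delta>
        using sub that C unfolding adequate_def by blast
    qed (use fin[OF ai] sig[OF ai] in auto)
    then show False using f by blast
  qed
  then show ?thesis using sig
    by (force simp: best_reply_meet_def profiles_def agent_choices_def)
qed

text \<open>The meet lies below \<open>\<sigma>\<close> and all of \<open>C\<close>, so the enlarged
  set is still a chain. Enlarging \<open>C\<close> can only shrink the meet, so the new meet is
  below the old one and hence below every member.\<close>

lemma adequate_insert_best_reply_meet:
  assumes "\<sigma> \<in> profiles I A S" "adequate I A S BR \<sigma> C"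
    and "best_reply_meet I A BR \<sigma> C \<in> profiles I A S"
  shows "adequate I A S BR \<sigma> (insert (best_reply_meet I A BR \<sigma> C) C)"
  using assms best_reply_meet_le[OF assms(1), of BR C]
    best_reply_meet_antimono[OF subset_insertI, of I A BR \<sigma> "best_reply_meet I A BR \<sigma> C" C]
  unfolding adequate_def by (auto intro: order_trans)

text \<open>Any two members of the union lie in a common member of \<open>F\<close>. The meet over
  the union is below the meet over each \<open>C\<close> in \<open>F\<close>, hence below the
  elements of \<open>C\<close>.\<close>

lemma adequate_Union:
  assumes F: "\<And>C. C \<in> F \<Longrightarrow> adequate I A S BR \<sigma> C"
    and ch: "\<And>C D. C \<in> F \<Longrightarrow> D \<in> F \<Longrightarrow> C \<subseteq> D \<or> D \<subseteq> C"
  shows "adequate I A S BR \<sigma> (\<Union>F)"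
  unfolding adequate_def
proof (intro conjI ballI)
  show "\<Union>F \<subseteq> profiles I A S" using F unfolding adequate_def by blast
next
  fix \<gamma> assume "\<gamma> \<in> \<Union>F"
  then obtain C where C: "C \<in> F" "\<gamma> \<in> C" by blast
  then show "\<gamma> \<le> \<sigma>" using F by (auto simp: adequate_def)
  have "best_reply_meet I A BR \<sigma> (\<Union>F) \<le> best_reply_meet I A BR \<sigma> C"
    using C by (intro best_reply_meet_antimono) blast
  then show "best_reply_meet I A BR \<sigma> (\<Union>F) \<le> \<gamma>"
    using C F unfolding adequate_def by (blast intro: order_trans)
next
  fix \<gamma> \<delta> assume "\<gamma> \<in> \<Union>F" "\<delta> \<in> \<Union>F"
  then obtain C D where "C \<in> F" "\<gamma> \<in> C" "D \<in> F" "\<delta> \<in> D" by blast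
  then show "\<gamma> \<le> \<delta> \<or> \<delta> \<le> \<gamma>" using ch[of C D] F unfolding adequate_def by blast
qed

theorem lemma21:
  fixes I :: "'i set" and A :: "'a set" and S :: "'i \<Rightarrow> 'a \<Rightarrow> 's set"
    and BR :: "'a \<Rightarrow> ('a \<Rightarrow> 'i \<Rightarrow> 's set) \<Rightarrow> 'i \<Rightarrow> 's set"
    and \<sigma> :: "'a \<Rightarrow> 'i \<Rightarrow> 's set"
  assumes game: "ndbr_game I A S BR"
    and sigma: "\<sigma> \<in> profiles I A S"
    and sigma_finite: "\<And>a i. a \<in> A \<Longrightarrow> i \<in> I \<Longrightarrow> finite (\<sigma> a i)"
    and chain: "chain_condition I A S BR \<sigma>"
  shows "\<exists>\<tau>. ndbr_equilibrium I A S BR \<tau>"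
proof -
  have "\<exists>M\<in>Collect (adequate I A S BR \<sigma>). \<forall>X\<in>Collect (adequate I A S BR \<sigma>). M \<subseteq> X \<longrightarrow> X = M"
  proof (rule subset_Zorn')
    \<comment> \<open>\<open>F\<close> may be empty; its union, the empty set, is adequate
      vacuously.\<close>
    fix F assume "subset.chain (Collect (adequate I A S BR \<sigma>)) F"
    then show "\<Union>F \<in> Collect (adequate I A S BR \<sigma>)"
      by (auto simp: subset_chain_def intro!: adequate_Union)
  qed
  then obtain M where M: "adequate I A S BR \<sigma> M"
    and maximal: "\<And>X. adequate I A S BR \<sigma> X \<Longrightarrow> M \<subseteq> X \<Longrightarrow> X = M" by auto
  define \<tau> where "\<tau> = best_reply_meet I A BR \<sigma> M"
  have tau: "\<tau> \<in> profiles I A S"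
    unfolding \<tau>_def using sigma sigma_finite chain M by (rule best_reply_meet_in_profiles)
  have "insert \<tau> M = M"
    using maximal adequate_insert_best_reply_meet[OF sigma M] tau by (auto simp: \<tau>_def)
  then have "\<tau> \<in> M" by blast
  then have "choice_subset I (\<tau> a) (BR a (others A a \<tau>))" if "a \<in> A" for a
    using that by (subst \<tau>_def) (auto simp: best_reply_meet_def choice_subset_def)
  then show ?thesis using tau by (auto simp: ndbr_equilibrium_def)
qed

end
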